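(* Let $M$ be an $n\times n$ matrix with non-negative integer entries. Then for every real $\alpha>0$ the set $\mathcal{A}_{\alpha}(M)=\{\mathbf{d}\in\mathbb{N}_+^n : \mathrm{diag}(\mathbf{d})-M \text{ is an } M\text{-matrix and } \det(\mathrm{diag}(\mathbf{d})-M)=\alpha\}$ is finite.
   Context: $\mathbb{N}_+$ denotes the positive integers and $\mathrm{diag}(\mathbf{d})$ the diagonal matrix with diagonal $\mathbf{d}$. A real square matrix is a $Z$-matrix if its off-diagonal entries are $\leq 0$; a $Z$-matrix $A$ is an $M$-matrix if $A=\beta I-B$ for some entrywise non-negative matrix $B$ and real $\beta\geq\rho(B)$, where $\rho(B)$ is the spectral radius of $B$. *)

theory Defs
  imports "Jordan_Normal_Form.Spectral_Radius" "Jordan_Normal_Form.Determinant"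
begin

definition Z_matrix :: "real mat \<Rightarrow> bool" where
  "Z_matrix A \<longleftrightarrow> square_mat A \<and>
     (\<forall>i < dim_row A. \<forall>j < dim_row A. i \<noteq> j \<longrightarrow> A $$ (i, j) \<le> 0)"

(* The spectral radius is taken over the complex spectrum.  In dimension 0 the spectrum is
   empty and spectral_radius is an unspecified real. *)
definition M_matrix :: "real mat \<Rightarrow> bool" where
  "M_matrix A \<longleftrightarrow> Z_matrix A \<and>
     (\<exists>B \<in> carrier_mat (dim_row A) (dim_row A). \<exists>\<beta> :: real.
        (\<forall>i < dim_row A. \<forall>j < dim_row A. 0 \<le> B $$ (i, j)) \<and>
        spectral_radius (map_mat complex_of_real B) \<le> \<beta> \<and>
        A = \<beta> \<cdot>\<^sub>m 1\<^sub>m (dim_row A) - B)"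

definition diag_minus :: "nat vec \<Rightarrow> nat mat \<Rightarrow> real mat" where
  "diag_minus d M = mat_diag (dim_vec d) (\<lambda>i. real (d $ i)) - map_mat real M"

definition \<A> :: "real \<Rightarrow> nat mat \<Rightarrow> nat vec set" where
  "\<A> \<alpha> M = {d \<in> carrier_vec (dim_row M).
     (\<forall>i < dim_row M. 0 < d $ i) \<and>
     M_matrix (diag_minus d M) \<and> det (diag_minus d M) = \<alpha>}"

end

theory Submission
  imports Defs
begin

text \<open>
  Raising a diagonal entry of a nonsingular M-matrix strictly increases its determinant, because
  the corresponding principal cofactor is positive. Hence the vectors \<open>d\<close> in question form an
  antichain in \<open>\<nat>\<^sup>n\<close>, and antichains are finite by Dickson's lemma.

  Positivity of the cofactors is obtained without Perron-Frobenius theory. If \<open>\<rho>(B) < g\<close>, a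
  truncated Neumann series gives \<open>x > 0\<close> with \<open>(g I - B) x > 0\<close>; for Z-matrices such an \<open>x\<close>
  forces a positive determinant and a nonnegative adjugate. In the boundary case \<open>\<beta> = \<rho>(B)\<close> apply
  this to \<open>A + t I\<close> and let \<open>t\<close> tend to \<open>0\<close>: the adjugate of \<open>A\<close> is nonnegative, and as
  \<open>det A > 0\<close> the vector \<open>x = adj(A) 1\<close> shows that \<open>A\<close> itself is of this kind.
\<close>

section \<open>Semipositive Z-matrices and the sign of their determinant\<close>

text \<open>Among Z-matrices this property characterises the nonsingular M-matrices. The witness is
  a function on indices, so that it enters the sums directly.\<close>

definition semipositive :: "nat \<Rightarrow> real mat \<Rightarrow> bool" where
  "semipositive n A \<longleftrightarrow> (\<exists>x :: nat \<Rightarrow> real. (\<forall>i<n. 0 < x i) \<and> (\<forall>i<n. 0 < (\<Sum>j<n. A $$ (i, j) * x j)))"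

lemma Z_matrix_off_diag:
  assumes "Z_matrix A" "A \<in> carrier_mat n n" "i < n" "j < n" "i \<noteq> j"
  shows "A $$ (i, j) \<le> 0"
  using assms by (auto simp: Z_matrix_def)

text \<open>Inverse positivity, phrased without an inverse. It drives both the nonsingularity of
  \<open>A\<close> and the sign of its adjugate.\<close>

lemma semipositive_Z_matrix_monotone:
  assumes A: "A \<in> carrier_mat n n" and Z: "Z_matrix A" and sp: "semipositive n A"
    and y: "\<And>i. i < n \<Longrightarrow> 0 \<le> (\<Sum>j<n. A $$ (i, j) * y j)"
    and k: "k < n"
  shows "0 \<le> y k"
proof -
  obtain x where x: "\<And>i. i < n \<Longrightarrow> 0 < x i"
    and Ax: "\<And>i. i < n \<Longrightarrow> 0 < (\<Sum>j<n. A $$ (i, j) * x j)"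
    using sp unfolding semipositive_def by auto
  \<comment> \<open>At an index minimising \<open>y i / x i = m\<close>, the sign pattern gives \<open>(A y) i \<le> m (A x) i\<close>.\<close>
  define i where "i = arg_min_on (\<lambda>i. y i / x i) {..<n}"
  have ne: "finite {..<n}" "{..<n} \<noteq> {}" using k by auto
  have i: "i < n"
    using arg_min_if_finite(1)[OF ne] unfolding i_def by auto
  have imin: "y i / x i \<le> y j / x j" if "j < n" for j
    using arg_min_least[OF ne] that unfolding i_def by auto
  define m where "m = y i / x i"
  have mx: "m * x j \<le> y j" if "j < n" for j
    using imin[OF that] x[OF that] unfolding m_def by (simp add: pos_le_divide_eq)
  have "(\<Sum>j<n. A $$ (i, j) * y j) \<le> (\<Sum>j<n. A $$ (i, j) * (m * x j))"
  proof (rule sum_mono)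
    fix j assume "j \<in> {..<n}"
    then have j: "j < n" by simp
    show "A $$ (i, j) * y j \<le> A $$ (i, j) * (m * x j)"
    proof (cases "j = i")
      case True
      then show ?thesis using x[OF i] unfolding m_def by simp
    next
      case False
      then show ?thesis
        using mx[OF j] Z_matrix_off_diag[OF Z A i j] by (intro mult_left_mono_neg) auto
    qed
  qed
  also have "\<dots> = m * (\<Sum>j<n. A $$ (i, j) * x j)"
    by (simp add: sum_distrib_left mult.left_commute)
  finally have "0 \<le> m * (\<Sum>j<n. A $$ (i, j) * x j)"
    using y[OF i] by linarith
  then have "0 \<le> m" using Ax[OF i] by (simp add: zero_le_mult_iff)
  then have "0 \<le> m * x k" using x[OF k] by simp
  then show ?thesis using mx[OF k] by linarith
qed

text \<open>For a kernel vector \<open>v\<close>, both \<open>v\<close> and \<open>-v\<close> have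
  image zero, so monotonicity makes both of them nonnegative.\<close>

lemma semipositive_det_nonzero:
  assumes A: "A \<in> carrier_mat n n" and Z: "Z_matrix A" and sp: "semipositive n A"
  shows "det A \<noteq> 0"
proof
  assume "det A = 0"
  then obtain v where v: "v \<in> carrier_vec n" "v \<noteq> 0\<^sub>v n" "A *\<^sub>v v = 0\<^sub>v n"
    using det_0_iff_vec_prod_zero[OF A] by auto
  have s: "(\<Sum>j<n. A $$ (i, j) * v $ j) = 0" if "i < n" for i
  proof -
    have "(\<Sum>j<n. A $$ (i, j) * v $ j) = (A *\<^sub>v v) $ i"
      using A v(1) that by (auto simp: scalar_prod_def lessThan_atLeast0)
    then show ?thesis using v(3) that by simp
  qed
  have "v $ k = 0" if "k < n" for k
  proof (rule antisym)
    show "0 \<le> v $ k"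
      by (rule semipositive_Z_matrix_monotone[OF A Z sp _ that]) (simp add: s)
    have "0 \<le> - v $ k"
      by (rule semipositive_Z_matrix_monotone[OF A Z sp _ that, of "\<lambda>k. - v $ k"])
        (simp add: s sum_negf)
    then show "v $ k \<le> 0" by simp
  qed
  then have "v = 0\<^sub>v n" using v(1) by auto
  then show False using v(2) by simp
qed

text \<open>The same witness \<open>x\<close> works: as \<open>x > 0\<close>, raising diagonal
  entries only raises the entries of the image.\<close>

lemma semipositive_diag_mono:
  assumes sp: "semipositive n A"
    and off: "\<And>i j. i < n \<Longrightarrow> j < n \<Longrightarrow> i \<noteq> j \<Longrightarrow> A' $$ (i, j) = A $$ (i, j)"
    and diag: "\<And>i. i < n \<Longrightarrow> A $$ (i, i) \<le> A' $$ (i, i)"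
  shows "semipositive n A'"
proof -
  obtain x where x: "\<And>i. i < n \<Longrightarrow> 0 < x i"
    and Ax: "\<And>i. i < n \<Longrightarrow> 0 < (\<Sum>j<n. A $$ (i, j) * x j)"
    using sp unfolding semipositive_def by auto
  have "0 < (\<Sum>j<n. A' $$ (i, j) * x j)" if i: "i < n" for i
  proof -
    have "(\<Sum>j<n. A $$ (i, j) * x j) \<le> (\<Sum>j<n. A' $$ (i, j) * x j)"
    proof (rule sum_mono)
      fix j assume "j \<in> {..<n}"
      then show "A $$ (i, j) * x j \<le> A' $$ (i, j) * x j"
        using off[OF i, of j] diag[OF i] x[of j] by (cases "i = j") (auto intro: mult_right_mono)
    qed
    then show ?thesis using Ax[OF i] by linarith
  qed
  then show ?thesis unfolding semipositive_def using x by blast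
qed

lemma Z_matrix_add_scalar:
  assumes "A \<in> carrier_mat n n" "Z_matrix A"
  shows "Z_matrix (A + t \<cdot>\<^sub>m 1\<^sub>m n)"
  using assms by (auto simp: Z_matrix_def)

text \<open>The determinant of \<open>A + t I\<close> is a monic polynomial in \<open>t\<close>. It
  has no zero for \<open>t >= 0\<close>, since \<open>A + t I\<close> stays semipositive, and it is
  positive for large \<open>t\<close>; hence it is positive at \<open>0\<close>.\<close>

lemma semipositive_det_pos:
  assumes A: "A \<in> carrier_mat n n" and Z: "Z_matrix A" and sp: "semipositive n A"
  shows "0 < det A"
proof (rule ccontr)
  define p where "p = char_poly (- A)"
  have mA: "- A \<in> carrier_mat n n" using A by simp
  have p: "poly p t = det (A + t \<cdot>\<^sub>m 1\<^sub>m n)" for t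
    unfolding p_def char_poly_matrix[OF mA] char_matrix_def
    by (rule arg_cong[of _ _ det], rule eq_matI) (use A in auto)
  have nz: "poly p t \<noteq> 0" if "0 \<le> t" for t
    unfolding p
  proof (rule semipositive_det_nonzero)
    show "semipositive n (A + t \<cdot>\<^sub>m 1\<^sub>m n)"
      by (rule semipositive_diag_mono[OF sp]) (use A that in auto)
  qed (use A Z Z_matrix_add_scalar in auto)
  have "A + 0 \<cdot>\<^sub>m 1\<^sub>m n = A" using A by (intro eq_matI) auto
  then have p0: "poly p 0 = det A" by (simp add: p)
  assume "\<not> 0 < det A"
  then have "poly p 0 < 0" using nz[of 0] p0 by simp
  moreover have lc: "lead_coeff p = 1"
    using degree_monic_char_poly[OF mA] unfolding p_def by simp
  obtain N where "\<forall>x\<ge>N. lead_coeff p \<le> poly p x"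
    using poly_pinfty_gt_lc[of p] lc by auto
  \<comment> \<open>The maximum with \<open>1\<close> keeps the right end of the interval strictly
    above \<open>0\<close>, whatever \<open>N\<close> is.\<close>
  then have "0 < poly p (max N 1)" using lc by (smt (verit) max.cobounded1)
  ultimately obtain t where "0 < t" "poly p t = 0"
    using poly_IVT_pos[of 0 "max N 1" p] by (auto simp: less_max_iff_disj)
  then show False using nz[of t] by simp
qed

section \<open>Signs of cofactors and the effect of a diagonal change\<close>

lemma row_mult_cofactor:
  assumes A: "A \<in> carrier_mat n n" and i: "i < n" and k: "k < n"
  shows "(\<Sum>j<n. A $$ (i, j) * cofactor A k j) = (if i = k then det A else 0)"
proof -
  have "(\<Sum>j<n. A $$ (i, j) * cofactor A k j) = (A * adj_mat A) $$ (i, k)"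
    using A i k by (auto simp: adj_mat_def scalar_prod_def lessThan_atLeast0)
  also have "\<dots> = (if i = k then det A else 0)"
    using adj_mat(2)[OF A] i k by simp
  finally show ?thesis .
qed

text \<open>The cofactors along row \<open>i\<close> form column \<open>i\<close> of the adjugate.
  \<open>A\<close> maps this column to \<open>det A\<close> times a unit vector, which is
  nonnegative.\<close>

lemma semipositive_cofactor_nonneg:
  assumes A: "A \<in> carrier_mat n n" and Z: "Z_matrix A" and sp: "semipositive n A"
    and i: "i < n" and j: "j < n"
  shows "0 \<le> cofactor A i j"
proof (rule semipositive_Z_matrix_monotone[OF A Z sp _ j, of "cofactor A i"])
  fix k assume "k < n"
  then show "0 \<le> (\<Sum>j<n. A $$ (k, j) * cofactor A i j)"
    using row_mult_cofactor[OF A _ i] semipositive_det_pos[OF A Z sp] by simp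
qed

text \<open>In the expansion of \<open>det A > 0\<close> along row \<open>i\<close> all off-diagonal
  terms are nonpositive, so the diagonal term has to be positive.\<close>

lemma semipositive_cofactor_diag_pos:
  assumes A: "A \<in> carrier_mat n n" and Z: "Z_matrix A" and sp: "semipositive n A"
    and i: "i < n"
  shows "0 < cofactor A i i"
proof -
  note nonneg = semipositive_cofactor_nonneg[OF A Z sp i]
  have "det A = A $$ (i, i) * cofactor A i i + (\<Sum>j\<in>{..<n} - {i}. A $$ (i, j) * cofactor A i j)"
    using row_mult_cofactor[OF A i i] i by (simp add: sum.remove)
  moreover have "(\<Sum>j\<in>{..<n} - {i}. A $$ (i, j) * cofactor A i j) \<le> 0"
    using Z_matrix_off_diag[OF Z A i] nonneg by (intro sum_nonpos mult_nonpos_nonneg) auto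
  ultimately have "0 < A $$ (i, i) * cofactor A i i"
    using semipositive_det_pos[OF A Z sp] by linarith
  then have "cofactor A i i \<noteq> 0" by auto
  then show ?thesis using nonneg[OF i] by simp
qed

text \<open>The cofactors along row \<open>i\<close> do not see row \<open>i\<close>, so the two
  expansions along that row differ in a single term.\<close>

lemma det_change_diag_entry:
  fixes A :: "'a :: comm_ring_1 mat"
  assumes A: "A \<in> carrier_mat n n" and A': "A' \<in> carrier_mat n n" and i: "i < n"
    and eq: "\<And>k j. k < n \<Longrightarrow> j < n \<Longrightarrow> (k, j) \<noteq> (i, i) \<Longrightarrow> A' $$ (k, j) = A $$ (k, j)"
  shows "det A' = det A + (A' $$ (i, i) - A $$ (i, i)) * cofactor A i i"
proof -
  have cof: "cofactor A' i j = cofactor A i j" if "j < n" for j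
  proof -
    have "mat_delete A' i j = mat_delete A i j"
      unfolding mat_delete_def using A A' i that by (intro eq_matI) (auto intro!: eq)
    then show ?thesis by (simp add: cofactor_def)
  qed
  have "det A' = (\<Sum>j<n. A' $$ (i, j) * cofactor A i j)"
    using laplace_expansion_row[OF A' i] cof by simp
  also have "\<dots> = A' $$ (i, i) * cofactor A i i + (\<Sum>j\<in>{..<n} - {i}. A' $$ (i, j) * cofactor A i j)"
    using i by (simp add: sum.remove)
  also have "(\<Sum>j\<in>{..<n} - {i}. A' $$ (i, j) * cofactor A i j)
      = (\<Sum>j\<in>{..<n} - {i}. A $$ (i, j) * cofactor A i j)"
    by (rule sum.cong) (use i eq in auto)
  also have "\<dots> = det A - A $$ (i, i) * cofactor A i i"
    using laplace_expansion_row[OF A i] i by (simp add: sum.remove)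
  finally show ?thesis by (simp add: algebra_simps)
qed

section \<open>Continuity of determinants and cofactors\<close>

text \<open>By the Leibniz formula the determinant is a finite sum of products of entries.\<close>

lemma tendsto_det:
  fixes F :: "'b \<Rightarrow> real mat"
  assumes F: "\<And>t. F t \<in> carrier_mat n n" and A: "A \<in> carrier_mat n n"
    and lim: "\<And>i j. i < n \<Longrightarrow> j < n \<Longrightarrow> ((\<lambda>t. F t $$ (i, j)) \<longlongrightarrow> A $$ (i, j)) G"
  shows "((\<lambda>t. det (F t)) \<longlongrightarrow> det A) G"
  unfolding det_def'[OF F] det_def'[OF A]
proof (intro tendsto_sum tendsto_mult tendsto_const tendsto_prod)
  fix p i assume "p \<in> {p. p permutes {0..<n}}" "i \<in> {0..<n}"
  then show "((\<lambda>t. F t $$ (i, p i)) \<longlongrightarrow> A $$ (i, p i)) G"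
    by (intro lim) (auto simp: permutes_in_image[of p "{0..<n}", simplified])
qed

lemma tendsto_cofactor:
  fixes F :: "'b \<Rightarrow> real mat"
  assumes F: "\<And>t. F t \<in> carrier_mat n n" and A: "A \<in> carrier_mat n n"
    and lim: "\<And>i j. i < n \<Longrightarrow> j < n \<Longrightarrow> ((\<lambda>t. F t $$ (i, j)) \<longlongrightarrow> A $$ (i, j)) G"
    and k: "k < n" and l: "l < n"
  shows "((\<lambda>t. cofactor (F t) k l) \<longlongrightarrow> cofactor A k l) G"
  unfolding cofactor_def
proof (intro tendsto_mult tendsto_const tendsto_det[where n = "n - 1"])
  fix i j assume "i < n - 1" "j < n - 1"
  then show "((\<lambda>t. mat_delete (F t) k l $$ (i, j)) \<longlongrightarrow> mat_delete A k l $$ (i, j)) G"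
    using A F k l carrier_matD[OF F] by (auto simp: mat_delete_def intro!: lim)
qed (use F A mat_delete_carrier in blast)+

section \<open>From the spectral radius to semipositivity\<close>

text \<open>If \<open>e\<close> is an eigenvalue of the scaled matrix, then \<open>g * e\<close> is
  one of \<open>B\<close> with the same eigenvector.\<close>

lemma spectral_radius_smult_less_1:
  assumes B: "B \<in> carrier_mat n n" and n: "0 < n" and g: "spectral_radius B < g"
  shows "spectral_radius (complex_of_real (1 / g) \<cdot>\<^sub>m B) < 1"
proof -
  let ?C = "complex_of_real (1 / g) \<cdot>\<^sub>m B"
  have C: "?C \<in> carrier_mat n n" using B by simp
  have "0 \<le> spectral_radius B" using spectral_radius_mem_max(1)[OF B n] by auto
  then have g0: "0 < g" using g by linarith
  obtain e where e: "e \<in> spectrum ?C" "spectral_radius ?C = norm e"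
    using spectral_radius_mem_max(1)[OF C n] by auto
  then obtain v where v: "eigenvector ?C v e"
    unfolding spectrum_def eigenvalue_def by auto
  then have vc: "v \<in> carrier_vec n" "v \<noteq> 0\<^sub>v n" "?C *\<^sub>v v = e \<cdot>\<^sub>v v"
    using B unfolding eigenvector_def by auto
  have "B *\<^sub>v v = complex_of_real g \<cdot>\<^sub>v (?C *\<^sub>v v)"
    using B vc(1) g0 by (intro eq_vecI) (auto simp: scalar_prod_def sum_distrib_left)
  also have "\<dots> = (complex_of_real g * e) \<cdot>\<^sub>v v"
    using vc by (simp add: smult_smult_assoc)
  finally have "eigenvector B v (complex_of_real g * e)"
    using vc B unfolding eigenvector_def by auto
  then have "complex_of_real g * e \<in> spectrum B"
    unfolding spectrum_def eigenvalue_def by auto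
  then have "norm (complex_of_real g * e) \<le> spectral_radius B"
    by (intro spectral_radius_mem_max(2)[OF B n]) auto
  then have "g * norm e < g * 1" using g0 g by (simp only: norm_mult norm_of_real)
  then show ?thesis using g0 e(2) by simp
qed

lemma nonneg_pow_mat:
  fixes A :: "real mat"
  assumes A: "A \<in> carrier_mat n n" and nn: "\<And>i j. i < n \<Longrightarrow> j < n \<Longrightarrow> 0 \<le> A $$ (i, j)"
    and i: "i < n" and j: "j < n"
  shows "0 \<le> (A ^\<^sub>m k) $$ (i, j)"
  using i j
proof (induction k arbitrary: i j)
  case 0
  then show ?case using A by auto
next
  case (Suc k)
  have "A ^\<^sub>m k \<in> carrier_mat n n" using A by simp
  then have "(A ^\<^sub>m Suc k) $$ (i, j) = (\<Sum>l<n. (A ^\<^sub>m k) $$ (i, l) * A $$ (l, j))"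
    using A Suc.prems by (auto simp: scalar_prod_def lessThan_atLeast0)
  then show ?case
    using Suc nn by (auto intro!: sum_nonneg)
qed

text \<open>Powers are defined by multiplication on the right; the recursion \<open>v_Suc\<close>
  below needs the new factor on the left.\<close>

lemma pow_mat_Suc_left:
  assumes A: "A \<in> carrier_mat n n"
  shows "A ^\<^sub>m Suc k = A * A ^\<^sub>m k"
proof (induction k)
  case 0
  then show ?case using A by simp
next
  case (Suc k)
  have "A ^\<^sub>m Suc (Suc k) = (A * A ^\<^sub>m k) * A" using Suc by simp
  also have "\<dots> = A * A ^\<^sub>m Suc k"
    using A by (simp add: assoc_mult_mat[of _ n n _ n _ n])
  finally show ?case .
qed

text \<open>With \<open>C = B / h\<close> and \<open>r = h / g\<close>, so that
  \<open>r C = B / g\<close>, the witness is the truncated Neumann series \<open>x\<close>, the sum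
  of \<open>r^k C^k 1\<close> over \<open>k < K\<close>. Telescoping gives
  \<open>(g I - B) x = g (1 - r^K C^K 1)\<close>, which is positive for large
  \<open>K\<close>.\<close>

lemma semipositive_if_spectral_radius_less:
  fixes B :: "real mat"
  assumes B: "B \<in> carrier_mat n n" and nn: "\<And>i j. i < n \<Longrightarrow> j < n \<Longrightarrow> 0 \<le> B $$ (i, j)"
    and g: "spectral_radius (map_mat complex_of_real B) < g"
  shows "semipositive n (g \<cdot>\<^sub>m 1\<^sub>m n - B)"
proof (cases "n = 0")
  \<comment> \<open>In dimension \<open>0\<close> the spectral radius is unspecified, but
    semipositivity is vacuous.\<close>
  case True
  then show ?thesis by (simp add: semipositive_def)
next
  case False
  then have n: "0 < n" by simp
  let ?B = "map_mat complex_of_real B"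
  have cB: "?B \<in> carrier_mat n n" using B by simp
  \<comment> \<open>The gap is split in two: below \<open>h\<close> lies the spectral radius, so the
    powers of \<open>B / h\<close> are bounded; above it lies \<open>g\<close>, so the powers of
    \<open>h / g\<close> decay.\<close>
  obtain h where h: "spectral_radius ?B < h" "h < g"
    using dense[OF g] by auto
  have "0 \<le> spectral_radius ?B" using spectral_radius_mem_max(1)[OF cB n] by auto
  then have h0: "0 < h" and g0: "0 < g" using h by linarith+
  define C where "C = (1 / h) \<cdot>\<^sub>m B"
  have C: "C \<in> carrier_mat n n" using B by (simp add: C_def)
  have Cij: "C $$ (i, j) = B $$ (i, j) / h" if "i < n" "j < n" for i j
    using B that by (simp add: C_def)
  have cC: "map_mat complex_of_real C = complex_of_real (1 / h) \<cdot>\<^sub>m ?B"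
    using B by (intro eq_matI) (auto simp: C_def)
  obtain c where c: "\<And>k. norm_bound (map_mat complex_of_real C ^\<^sub>m k) c"
    using spectral_radius_jnf_norm_bound_less_1_upper_triangular[of "map_mat complex_of_real C" n]
      spectral_radius_smult_less_1[OF cB n h(1)] C unfolding cC[symmetric] by auto
  have Ck: "C ^\<^sub>m k \<in> carrier_mat n n" for k using C by simp
  have le_c: "(C ^\<^sub>m k) $$ (i, j) \<le> c" if "i < n" "j < n" for i j k
  proof -
    have "map_mat complex_of_real C ^\<^sub>m k = map_mat complex_of_real (C ^\<^sub>m k)"
      by (rule of_real_hom.mat_hom_pow[OF C, symmetric])
    then have "norm (complex_of_real ((C ^\<^sub>m k) $$ (i, j))) \<le> c"
      using c[of k] C that unfolding norm_bound_def by auto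
    then show ?thesis by simp
  qed
  \<comment> \<open>\<open>v k\<close> is \<open>C^k\<close> applied to the all-ones vector.\<close>
  define v where "v k i = (\<Sum>j<n. (C ^\<^sub>m k) $$ (i, j))" for k i
  have v0: "v 0 i = 1" if "i < n" for i
    using C that by (simp add: v_def sum.remove[of _ i])
  have v_nonneg: "0 \<le> v k i" if "i < n" for k i
    unfolding v_def using that nn h0
    by (intro sum_nonneg nonneg_pow_mat[OF C]) (auto simp: Cij)
  have v_le: "v k i \<le> n * c" if "i < n" for k i
    unfolding v_def using sum_bounded_above[of "{..<n}" "\<lambda>j. (C ^\<^sub>m k) $$ (i, j)" c] le_c that by simp
  have v_Suc: "(\<Sum>j<n. C $$ (i, j) * v k j) = v (Suc k) i" if "i < n" for k i
  proof -
    have "v (Suc k) i = (\<Sum>l<n. \<Sum>j<n. C $$ (i, j) * (C ^\<^sub>m k) $$ (j, l))"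
      unfolding v_def pow_mat_Suc_left[OF C] using C Ck[of k] that
      by (intro sum.cong) (auto simp: scalar_prod_def lessThan_atLeast0)
    also have "\<dots> = (\<Sum>j<n. \<Sum>l<n. C $$ (i, j) * (C ^\<^sub>m k) $$ (j, l))"
      by (rule sum.swap)
    finally show ?thesis by (simp add: v_def sum_distrib_left)
  qed
  define r where "r = h / g"
  have r: "0 < r" "r < 1" using h h0 g0 by (auto simp: r_def)
  have c0: "0 \<le> n * c" using v_nonneg[OF n] v_le[OF n] by (rule order_trans)
  \<comment> \<open>\<open>n * c\<close> bounds every \<open>v k i\<close>; the added
    \<open>1\<close> keeps the denominator positive even if \<open>c = 0\<close>.\<close>
  obtain K0 where K0: "r ^ K0 < 1 / (n * c + 1)"
    using real_arch_pow_inv[of "1 / (n * c + 1)" r] r c0 by auto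
  \<comment> \<open>One more than \<open>K0\<close>, so that the sum defining \<open>x\<close>
    contains its term for \<open>k = 0\<close>. This term is \<open>1\<close> and makes
    \<open>x\<close> positive.\<close>
  define K where "K = Suc K0"
  have "r ^ K \<le> r ^ K0" using r by (simp add: K_def mult_left_le_one_le)
  then have "r ^ K < 1 / (n * c + 1)" using K0 by linarith
  then have "r ^ K * (n * c + 1) < 1" using c0 by (simp add: pos_less_divide_eq)
  then have rK: "r ^ K * (n * c) < 1" using r by (simp add: distrib_left) (smt (verit) zero_less_power)
  define x where "x i = (\<Sum>k<K. r ^ k * v k i)" for i
  have x_pos: "0 < x i" if "i < n" for i
  proof -
    have "0 \<le> (\<Sum>k<K0. r ^ Suc k * v (Suc k) i)"
      using r v_nonneg[OF that] by (intro sum_nonneg) auto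
    then show ?thesis unfolding x_def K_def sum.lessThan_Suc_shift using v0[OF that] by simp
  qed
  have "0 < (\<Sum>j<n. (g \<cdot>\<^sub>m 1\<^sub>m n - B) $$ (i, j) * x j)" if i: "i < n" for i
  proof -
    have "(\<Sum>j<n. C $$ (i, j) * x j) = (\<Sum>j<n. \<Sum>k<K. r ^ k * (C $$ (i, j) * v k j))"
      by (simp add: x_def sum_distrib_left mult.left_commute)
    also have "\<dots> = (\<Sum>k<K. r ^ k * (\<Sum>j<n. C $$ (i, j) * v k j))"
      by (subst sum.swap) (simp add: sum_distrib_left)
    also have "\<dots> = (\<Sum>k<K. r ^ k * v (Suc k) i)" using v_Suc[OF i] by simp
    finally have Cx: "(\<Sum>j<n. C $$ (i, j) * x j) = (\<Sum>k<K. r ^ k * v (Suc k) i)" .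
    have "(\<Sum>j<n. (g \<cdot>\<^sub>m 1\<^sub>m n - B) $$ (i, j) * x j)
        = (\<Sum>j<n. (if i = j then g * x j else 0) - h * (C $$ (i, j) * x j))"
      using B i h0 by (intro sum.cong) (auto simp: Cij algebra_simps)
    also have "\<dots> = g * x i - h * (\<Sum>j<n. C $$ (i, j) * x j)"
      using i by (simp add: sum_subtractf sum_distrib_left)
    also have "\<dots> = g * (x i - r * (\<Sum>k<K. r ^ k * v (Suc k) i))"
      unfolding Cx using g0 by (simp add: r_def right_diff_distrib)
    also have "x i - r * (\<Sum>k<K. r ^ k * v (Suc k) i)
        = (\<Sum>k<K. r ^ k * v k i - r ^ Suc k * v (Suc k) i)"
      by (simp add: x_def sum_subtractf sum_distrib_left mult.assoc)
    also have "\<dots> = 1 - r ^ K * v K i"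
      using sum_lessThan_telescope'[of "\<lambda>k. r ^ k * v k i" K] v0[OF i] by simp
    finally have "(\<Sum>j<n. (g \<cdot>\<^sub>m 1\<^sub>m n - B) $$ (i, j) * x j) = g * (1 - r ^ K * v K i)" .
    moreover have "r ^ K * v K i \<le> r ^ K * (n * c)"
      using r v_le[OF i] by (intro mult_left_mono) auto
    ultimately show ?thesis using rK g0 by simp
  qed
  then show ?thesis unfolding semipositive_def using x_pos by blast
qed

section \<open>M-matrices with positive determinant\<close>

lemma M_matrix_semipositive:
  assumes A: "A \<in> carrier_mat n n" and M: "M_matrix A" and det: "0 < det A"
  shows "semipositive n A"
proof -
  have Z: "Z_matrix A" using M by (simp add: M_matrix_def)
  obtain B \<beta> where B: "B \<in> carrier_mat n n" and nn: "\<And>i j. i < n \<Longrightarrow> j < n \<Longrightarrow> 0 \<le> B $$ (i, j)"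
    and \<beta>: "spectral_radius (map_mat complex_of_real B) \<le> \<beta>" and AB: "A = \<beta> \<cdot>\<^sub>m 1\<^sub>m n - B"
    using M A unfolding M_matrix_def by auto
  have sp: "semipositive n (A + t \<cdot>\<^sub>m 1\<^sub>m n)" if "0 < t" for t
  proof -
    have "A + t \<cdot>\<^sub>m 1\<^sub>m n = (\<beta> + t) \<cdot>\<^sub>m 1\<^sub>m n - B"
      using B by (intro eq_matI) (auto simp: AB algebra_simps)
    then show ?thesis
      using semipositive_if_spectral_radius_less[OF B nn, of "\<beta> + t"] \<beta> that by simp
  qed
  \<comment> \<open>\<open>\<beta>\<close> may equal the spectral radius, so only the matrices
    \<open>A + t I\<close> with \<open>t > 0\<close> are known to be semipositive. Nonnegativity of
    their cofactors survives the limit from the right.\<close>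
  have nonneg: "0 \<le> cofactor A i j" if ij: "i < n" "j < n" for i j
  proof (rule tendsto_lowerbound)
    show "((\<lambda>t. cofactor (A + t \<cdot>\<^sub>m 1\<^sub>m n) i j) \<longlongrightarrow> cofactor A i j) (at_right 0)"
    proof (rule tendsto_cofactor[OF _ A _ ij])
      fix k l assume "k < n" "l < n"
      then have "(\<lambda>t. (A + t \<cdot>\<^sub>m 1\<^sub>m n) $$ (k, l)) = (\<lambda>t. A $$ (k, l) + t * (if k = l then 1 else 0))"
        using A by auto
      moreover have "((\<lambda>t. A $$ (k, l) + t * (if k = l then 1 else 0))
          \<longlongrightarrow> A $$ (k, l) + 0 * (if k = l then 1 else 0)) (at_right 0)"
        by (intro tendsto_intros)
      ultimately show "((\<lambda>t. (A + t \<cdot>\<^sub>m 1\<^sub>m n) $$ (k, l)) \<longlongrightarrow> A $$ (k, l)) (at_right 0)"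
        by simp
    qed (use A in auto)
    show "\<forall>\<^sub>F t in at_right 0. 0 \<le> cofactor (A + t \<cdot>\<^sub>m 1\<^sub>m n) i j"
      unfolding eventually_at_right_field
      using semipositive_cofactor_nonneg[OF _ Z_matrix_add_scalar[OF A Z] sp ij] A
      by (intro exI[of _ 1]) auto
  qed simp
  \<comment> \<open>The row sums of the adjugate, that is \<open>x = adj(A) 1\<close>, whence
    \<open>A x = det(A) 1\<close>.\<close>
  define x where "x i = (\<Sum>k<n. cofactor A k i)" for i
  have Ax: "(\<Sum>j<n. A $$ (i, j) * x j) = det A" if i: "i < n" for i
  proof -
    have "(\<Sum>j<n. A $$ (i, j) * x j) = (\<Sum>k<n. \<Sum>j<n. A $$ (i, j) * cofactor A k j)"
      unfolding x_def sum_distrib_left by (rule sum.swap)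
    also have "\<dots> = (\<Sum>k<n. if i = k then det A else 0)"
      using row_mult_cofactor[OF A i] by simp
    finally show ?thesis using i by simp
  qed
  have x_nonneg: "0 \<le> x i" if "i < n" for i
    unfolding x_def using nonneg that by (intro sum_nonneg) auto
  \<comment> \<open>If \<open>x i\<close> were \<open>0\<close>, entry \<open>i\<close> of
    \<open>A x\<close> would be a sum of nonpositive terms, yet it equals
    \<open>det A > 0\<close>.\<close>
  have "0 < x i" if i: "i < n" for i
  proof -
    have "(\<Sum>j<n. A $$ (i, j) * x j) = A $$ (i, i) * x i + (\<Sum>j\<in>{..<n} - {i}. A $$ (i, j) * x j)"
      using i by (simp add: sum.remove)
    moreover have "(\<Sum>j\<in>{..<n} - {i}. A $$ (i, j) * x j) \<le> 0"
      using Z_matrix_off_diag[OF Z A i] x_nonneg by (intro sum_nonpos mult_nonpos_nonneg) auto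
    ultimately have "x i \<noteq> 0" using Ax[OF i] det by auto
    then show ?thesis using x_nonneg[OF i] by simp
  qed
  then show ?thesis unfolding semipositive_def using Ax det by (intro exI[of _ x]) simp
qed

section \<open>Strict monotonicity of the determinant in the diagonal\<close>

text \<open>Diagonal entries are raised one at a time. Each intermediate matrix is again a
  semipositive Z-matrix, so each step adds the increment times a positive cofactor.\<close>

lemma semipositive_det_strict_mono:
  assumes A: "A \<in> carrier_mat n n" and A': "A' \<in> carrier_mat n n"
    and Z: "Z_matrix A" and sp: "semipositive n A"
    and off: "\<And>i j. i < n \<Longrightarrow> j < n \<Longrightarrow> i \<noteq> j \<Longrightarrow> A' $$ (i, j) = A $$ (i, j)"
    and diag: "\<And>i. i < n \<Longrightarrow> A $$ (i, i) \<le> A' $$ (i, i)"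
    and strict: "i < n" "A $$ (i, i) < A' $$ (i, i)"
  shows "det A < det A'"
proof -
  \<comment> \<open>\<open>C k\<close> has its first \<open>k\<close> rows from \<open>A'\<close>.
    As the off-diagonal entries agree, \<open>C k\<close> and \<open>C (Suc k)\<close> can differ
    only at \<open>(k, k)\<close>.\<close>
  define C where "C k = mat n n (\<lambda>(i, j). if i < k then A' $$ (i, j) else A $$ (i, j))" for k
  have C: "C k \<in> carrier_mat n n" for k by (simp add: C_def)
  have spC: "semipositive n (C k)" for k
    by (rule semipositive_diag_mono[OF sp]) (auto simp: C_def off diag)
  have ZC: "Z_matrix (C k)" for k
    using Z_matrix_off_diag[OF Z A] by (auto simp: C_def Z_matrix_def off)
  have step: "det (C (Suc k)) = det (C k) + (A' $$ (k, k) - A $$ (k, k)) * cofactor (C k) k k"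
    if "k < n" for k
  proof -
    have "C (Suc k) $$ (k, k) = A' $$ (k, k)" "C k $$ (k, k) = A $$ (k, k)"
      using that by (auto simp: C_def)
    then show ?thesis
      using det_change_diag_entry[OF C C that, of "Suc k" k] off by (force simp: C_def less_Suc_eq)
  qed
  \<comment> \<open>Strictness appears once row \<open>i\<close> has been replaced, that is from
    \<open>k = i + 1\<close> on.\<close>
  have "det A \<le> det (C k) \<and> (i < k \<longrightarrow> det A < det (C k))" if "k \<le> n" for k
    using that
  proof (induction k)
    case 0
    have "C 0 = A" using A by (intro eq_matI) (auto simp: C_def)
    then show ?case by simp
  next
    case (Suc k)
    then have k: "k < n" by simp
    have pos: "0 < cofactor (C k) k k"
      by (rule semipositive_cofactor_diag_pos[OF C ZC spC k])
    then have "0 \<le> (A' $$ (k, k) - A $$ (k, k)) * cofactor (C k) k k"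
      using diag[OF k] by simp
    moreover have "0 < (A' $$ (k, k) - A $$ (k, k)) * cofactor (C k) k k" if "k = i"
      using strict pos that by simp
    ultimately show ?case using Suc.IH k step[OF k] by (cases "k = i") (auto simp: less_Suc_eq)
  qed
  moreover have "C n = A'" using A' by (intro eq_matI) (auto simp: C_def)
  ultimately show ?thesis using strict(1) by force
qed

section \<open>Dickson's lemma and finiteness of antichains\<close>

text \<open>There is a monotone subsequence. If it decreases, well-foundedness makes it constant
  from the point where it attains its minimum, and that tail serves.\<close>

lemma nat_seq_incseq_subseq:
  fixes f :: "nat \<Rightarrow> nat"
  shows "\<exists>g. strict_mono g \<and> incseq (f \<circ> g)"
proof -
  obtain g where g: "strict_mono g" "monoseq (\<lambda>k. f (g k))"
    using seq_monosub[of f] by auto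
  show ?thesis
  proof (cases "incseq (\<lambda>k. f (g k))")
    case True
    then show ?thesis using g by (auto simp: comp_def)
  next
    case False
    then have dec: "decseq (\<lambda>k. f (g k))" using g(2) by (auto simp: monoseq_iff)
    define m where "m = (LEAST y. y \<in> range (\<lambda>k. f (g k)))"
    have "m \<in> range (\<lambda>k. f (g k))" unfolding m_def by (rule LeastI[of _ "f (g 0)"]) auto
    then obtain N where N: "f (g N) = m" by auto
    have "f (g (k + N)) = m" for k
    proof (rule antisym)
      show "f (g (k + N)) \<le> m" using decseqD[OF dec, of N "k + N"] N by simp
      show "m \<le> f (g (k + N))" unfolding m_def by (rule Least_le) auto
    qed
    then have "incseq (f \<circ> (\<lambda>k. g (k + N)))" by (simp add: incseq_def)
    moreover have "strict_mono (\<lambda>k. g (k + N))" using g(1) by (simp add: strict_mono_def)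
    ultimately show ?thesis by blast
  qed
qed

text \<open>Coordinates are treated one after the other: a further subsequence keeps the earlier
  ones monotone.\<close>

lemma dickson_incseq_subseq:
  fixes f :: "nat \<Rightarrow> nat \<Rightarrow> nat"
  shows "\<exists>g. strict_mono g \<and> (\<forall>i<n. incseq (\<lambda>k. f (g k) i))"
proof (induction n)
  case 0
  then show ?case by (intro exI[of _ id]) (simp add: strict_mono_def)
next
  case (Suc n)
  then obtain g where g: "strict_mono g" "\<And>i. i < n \<Longrightarrow> incseq (\<lambda>k. f (g k) i)" by auto
  obtain g' where g': "strict_mono g'" "incseq ((\<lambda>k. f (g k) n) \<circ> g')"
    using nat_seq_incseq_subseq by blast
  have "incseq (\<lambda>k. f (g (g' k)) i)" if "i < Suc n" for i
  proof (cases "i = n")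
    case True
    then show ?thesis using g'(2) by (simp add: comp_def)
  next
    case False
    then have "incseq (\<lambda>k. f (g k) i)" using g(2) that by simp
    then show ?thesis using strict_mono_mono[OF g'(1)] by (auto simp: incseq_def mono_def)
  qed
  moreover have "strict_mono (\<lambda>k. g (g' k))" using g(1) g'(1) by (simp add: strict_mono_def)
  ultimately show ?case by blast
qed

text \<open>An injective sequence in an infinite \<open>S\<close> would have two comparable terms at
  distinct indices; the antichain property identifies them, against injectivity.\<close>

lemma finite_antichain_nat_vec:
  fixes S :: "nat vec set"
  assumes S: "S \<subseteq> carrier_vec n"
    and anti: "\<And>d d'. d \<in> S \<Longrightarrow> d' \<in> S \<Longrightarrow> \<forall>i<n. d $ i \<le> d' $ i \<Longrightarrow> d = d'"
  shows "finite S"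
proof (rule ccontr)
  assume "infinite S"
  then obtain s :: "nat \<Rightarrow> nat vec" where s: "inj s" "range s \<subseteq> S"
    using infinite_countable_subset by blast
  obtain g where g: "strict_mono g" "\<And>i. i < n \<Longrightarrow> incseq (\<lambda>k. s (g k) $ i)"
    using dickson_incseq_subseq[of n "\<lambda>k i. s k $ i"] by auto
  have "s (g 0) = s (g 1)"
    using s(2) g(2) by (intro anti) (auto simp: incseq_def)
  then have "g 0 = g 1" using s(1) by (simp add: inj_eq)
  then show False using g(1) strict_mono_eq by fastforce
qed

theorem theorem2p5:
  fixes M :: "nat mat" and n :: nat and \<alpha> :: real
  assumes "M \<in> carrier_mat n n" and "\<alpha> > 0"
  shows "finite (\<A> \<alpha> M)"
proof (rule finite_antichain_nat_vec)
  show "\<A> \<alpha> M \<subseteq> carrier_vec n" using assms(1) by (auto simp: \<A>_def)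
next
  fix d d' assume d: "d \<in> \<A> \<alpha> M" and d': "d' \<in> \<A> \<alpha> M" and le: "\<forall>i<n. d $ i \<le> d' $ i"
  have dc: "d \<in> carrier_vec n" "d' \<in> carrier_vec n"
    and M: "M_matrix (diag_minus d M)"
    and det: "det (diag_minus d M) = \<alpha>" "det (diag_minus d' M) = \<alpha>"
    using d d' assms(1) by (auto simp: \<A>_def)
  have A: "diag_minus e M \<in> carrier_mat n n" if "e \<in> carrier_vec n" for e
    using that assms(1) unfolding diag_minus_def by (intro carrier_matI) auto
  have entry: "diag_minus e M $$ (i, j) = (if i = j then real (e $ i) else 0) - real (M $$ (i, j))"
    if "e \<in> carrier_vec n" "i < n" "j < n" for e i j
    using that assms(1) by (auto simp: diag_minus_def mat_diag_def)
  \<comment> \<open>Here \<open>\<alpha> > 0\<close> enters: it excludes singular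
    M-matrices.\<close>
  have sp: "semipositive n (diag_minus d M)"
    using M_matrix_semipositive[OF A[OF dc(1)] M] det assms(2) by simp
  have Z: "Z_matrix (diag_minus d M)" using M by (simp add: M_matrix_def)
  show "d = d'"
  proof (rule ccontr)
    assume "d \<noteq> d'"
    then obtain i where i: "i < n" "d $ i \<noteq> d' $ i"
      using dc by (metis carrier_vecD eq_vecI)
    then have lt: "d $ i < d' $ i" using le by (simp add: le_neq_implies_less)
    have "det (diag_minus d M) < det (diag_minus d' M)"
      by (rule semipositive_det_strict_mono[OF A[OF dc(1)] A[OF dc(2)] Z sp _ _ i(1)])
        (use le lt i in \<open>auto simp: entry dc\<close>)
    then show False using det by simp
  qed
qed

end
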